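(* Let $\|\cdot\|$ be a norm on functions on $X$ with $\|\cdot\|_\infty\le\|\cdot\|$. (1) Assume that there exist $C>0$ and $\zeta\in(0,1)$ such that for all functions $H,G$ of the form $H(x,y)=h(x)h(y)$ and $G(\omega,x,y)=(g(x)-\widehat\mu_\omega(g))(g(y)-\widehat\mu_\omega(g))$ with $\|g\|,\|h\|\le1$, and all $n\in\mathbb N$, $$\left|\int G\cdot(H\circ F_2^n)\,d\widehat\mu^{(2)}\right|\le C\zeta^n.$$ Then for all functions $g,h:X\to\mathbb R$ with $\|g\|,\|h\|\le1$ and every $1\le p<\infty$ there exist a constant $c_p>0$ and a random variable $R_p\in L^p(\mu)$ such that for $\mu$-a.e. $\omega$ and all $n\in\mathbb N$, $$\left|\int g\cdot(h\circ f_\omega^n)\,d\widehat\mu_\omega-\left(\int g\,d\widehat\mu_\omega\right)\left(\int h\circ f_\omega^n\,d\widehat\mu_\omega\right)\right|\le R_p(\omega)e^{-c_pn}.$$ (2) Suppose moreover that $\widehat\mu$ is $F_1$-invariant or that $\widehat\mu_\omega$ and $X_\omega$ do not depend on $\omega$. Let $g,h:X\to\mathbb R$ with $\|g\|,\|h\|\le1$ and $\nu(g)=0$, where $\nu$ is the projection of $\widehat\mu$ to $X$. Let $H(x,y)=h(x)h(y)$ and $\widetilde G(x,y)=g(x)g(y)$. If there are $C>0$, $\zeta\in(0,1)$ such that for all $n\in\mathbb N$ $$\left|\int\widetilde G\cdot(H\circ F_2^n)\,d\widehat\mu^{(2)}\right|\le C\zeta^n,$$ then for all $1\le p<\infty$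 there are a constant $c_p>0$ and a random variable $R_p\in L^p(\mu)$ such that for $\mu$-a.e. $\omega$ and all $n\in\mathbb N$, $$\left|\int g\cdot(h\circ f_\omega^n)\,d\widehat\mu_\omega\right|\le R_p(\omega)e^{-c_pn}.$$
   Context: Let $(\Sigma,\mathcal F,\mu)$ be a probability space and $T:\Sigma\to\Sigma$ a measurable $\mu$-preserving map. Let $X$ be a measurable space and $X_\omega\subset X$, $\omega\in\Sigma$, subsets such that $\mathcal E=\{(\omega,x):\omega\in\Sigma,\ x\in X_\omega\}$ is a measurable subset of $\Sigma\times X$. Let $f_\omega:X_\omega\to X_{T\omega}$ be maps such that $F_1:\mathcal E\to\mathcal E$, $F_1(\omega,x)=(T\omega,f_\omega x)$, is measurable. Let $\mathcal E_2=\{(\omega,x,y):\omega\in\Sigma,\ x,y\in X_\omega\}$ and $F_2(\omega,x,y)=(T\omega,f_\omega x,f_\omega y)$. Write $f_\omega^n=f_{T^{n-1}\omega}\circ\cdots\circ f_\omega$. Fix a probability measure $\widehat\mu=\int\widehat\mu_\omega\,d\mu(\omega)$ on $\mathcal E$, where $\widehat\mu_\omega$ is a probability measure on $X_\omega$, and put $\widehat\mu^{(2)}=\int\widehat\mu_\omega\times\widehat\mu_\omega\,d\mu(\omega)$. Write $\widehat\mu_\omega(g)=\int g\,d\widehat\mu_\omega$. Functions on $X\times X$ are regarded as functions on $\mathcal E_2$ not depending on $\omega$. $\|\cdot\|_\infty$ is the supremum norm; functions with finite norm are understood to be measurable. *)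

theory Defs
  imports "HOL-Probability.Probability"
begin

text \<open>
  \<open>M\<close> is the probability space \<open>(\<Sigma>, \<F>, \<mu>)\<close>, \<open>Xs \<omega>\<close> is the fibre \<open>X\<^sub>\<omega>\<close> and \<open>m \<omega>\<close> the probability
  measure on it. The measurable space \<open>X\<close> is the value \<open>MX\<close> of type \<^typ>\<open>'x measure\<close>, of which only
  \<open>space MX\<close> and \<open>sets MX\<close> matter; likewise only the sigma-algebras of \<open>E1_space\<close> and \<open>E2_space\<close> matter.
  A point \<open>(\<omega>, x, y)\<close> is the nested pair \<open>(\<omega>, (x, y))\<close>.
\<close>

definition E1 :: "'w measure \<Rightarrow> ('w \<Rightarrow> 'x set) \<Rightarrow> ('w \<times> 'x) set" where
  "E1 M Xs = {(\<omega>, x). \<omega> \<in> space M \<and> x \<in> Xs \<omega>}"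

definition E1_space :: "'w measure \<Rightarrow> 'x measure \<Rightarrow> ('w \<Rightarrow> 'x set) \<Rightarrow> ('w \<times> 'x) measure" where
  "E1_space M MX Xs = restrict_space (M \<Otimes>\<^sub>M MX) (E1 M Xs)"

definition F1 :: "('w \<Rightarrow> 'w) \<Rightarrow> ('w \<Rightarrow> 'x \<Rightarrow> 'x) \<Rightarrow> 'w \<times> 'x \<Rightarrow> 'w \<times> 'x" where
  "F1 T f = (\<lambda>(\<omega>, x). (T \<omega>, f \<omega> x))"

definition E2 :: "'w measure \<Rightarrow> ('w \<Rightarrow> 'x set) \<Rightarrow> ('w \<times> 'x \<times> 'x) set" where
  "E2 M Xs = {(\<omega>, x, y). \<omega> \<in> space M \<and> x \<in> Xs \<omega> \<and> y \<in> Xs \<omega>}"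

definition E2_space :: "'w measure \<Rightarrow> 'x measure \<Rightarrow> ('w \<Rightarrow> 'x set) \<Rightarrow> ('w \<times> 'x \<times> 'x) measure" where
  "E2_space M MX Xs = restrict_space (M \<Otimes>\<^sub>M (MX \<Otimes>\<^sub>M MX)) (E2 M Xs)"

definition F2 :: "('w \<Rightarrow> 'w) \<Rightarrow> ('w \<Rightarrow> 'x \<Rightarrow> 'x) \<Rightarrow> 'w \<times> 'x \<times> 'x \<Rightarrow> 'w \<times> 'x \<times> 'x" where
  "F2 T f = (\<lambda>(\<omega>, x, y). (T \<omega>, f \<omega> x, f \<omega> y))"

primrec fiter :: "('w \<Rightarrow> 'w) \<Rightarrow> ('w \<Rightarrow> 'x \<Rightarrow> 'x) \<Rightarrow> nat \<Rightarrow> 'w \<Rightarrow> 'x \<Rightarrow> 'x" where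
  "fiter T f 0 \<omega> = id"
| "fiter T f (Suc n) \<omega> = f ((T ^^ n) \<omega>) \<circ> fiter T f n \<omega>"

text \<open>
  The integrals of measures \<open>\<integral> m\<^sub>\<omega> d\<mu>(\<omega>)\<close> and \<open>\<integral> m\<^sub>\<omega> \<times> m\<^sub>\<omega> d\<mu>(\<omega>)\<close>, as Giry-monad binds of the
  measures on the fibres, pushed forward along \<open>x \<mapsto> (\<omega>, x)\<close> and \<open>(x, y) \<mapsto> (\<omega>, x, y)\<close>.
\<close>

definition mu_hat ::
  "'w measure \<Rightarrow> 'x measure \<Rightarrow> ('w \<Rightarrow> 'x set) \<Rightarrow> ('w \<Rightarrow> 'x measure) \<Rightarrow> ('w \<times> 'x) measure" where
  "mu_hat M MX Xs m = M \<bind> (\<lambda>\<omega>. distr (m \<omega>) (E1_space M MX Xs) (\<lambda>x. (\<omega>, x)))"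

definition mu_hat2 ::
  "'w measure \<Rightarrow> 'x measure \<Rightarrow> ('w \<Rightarrow> 'x set) \<Rightarrow> ('w \<Rightarrow> 'x measure) \<Rightarrow> ('w \<times> 'x \<times> 'x) measure" where
  "mu_hat2 M MX Xs m =
     M \<bind> (\<lambda>\<omega>. distr (m \<omega> \<Otimes>\<^sub>M m \<omega>) (E2_space M MX Xs) (\<lambda>(x, y). (\<omega>, x, y)))"

text \<open>
  The standing assumptions. Each \<open>m \<omega>\<close> lives on the fibre itself (with the trace sigma-algebra), since
  \<open>f \<omega>\<close> is only controlled there. The assumption \<open>kernel\<close> says that \<open>\<omega> \<mapsto> m\<^sub>\<omega> {x. (\<omega>, x) \<in> A}\<close> is
  measurable for every measurable subset \<open>A\<close> of \<open>E1\<close>, which is what gives \<open>\<integral> m\<^sub>\<omega> d\<mu>(\<omega>)\<close> a meaning.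
\<close>

locale random_system = prob_space M
  for M :: "'w measure" and T :: "'w \<Rightarrow> 'w" and MX :: "'x measure"
    and Xs :: "'w \<Rightarrow> 'x set" and f :: "'w \<Rightarrow> 'x \<Rightarrow> 'x" and m :: "'w \<Rightarrow> 'x measure" +
  assumes T_measurable: "T \<in> M \<rightarrow>\<^sub>M M"
    and T_preserving: "distr M M T = M"
    and fibre_subset: "\<And>\<omega>. \<omega> \<in> space M \<Longrightarrow> Xs \<omega> \<subseteq> space MX"
    and E1_measurable: "E1 M Xs \<in> sets (M \<Otimes>\<^sub>M MX)"
    and f_maps: "\<And>\<omega>. \<omega> \<in> space M \<Longrightarrow> f \<omega> \<in> Xs \<omega> \<rightarrow> Xs (T \<omega>)"
    and F1_measurable: "F1 T f \<in> E1_space M MX Xs \<rightarrow>\<^sub>M E1_space M MX Xs"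
    and fibre_prob: "\<And>\<omega>. \<omega> \<in> space M \<Longrightarrow> prob_space (m \<omega>)"
    and fibre_sets: "\<And>\<omega>. \<omega> \<in> space M \<Longrightarrow> sets (m \<omega>) = sets (restrict_space MX (Xs \<omega>))"
    and kernel: "(\<lambda>\<omega>. distr (m \<omega>) (E1_space M MX Xs) (\<lambda>x. (\<omega>, x)))
                   \<in> M \<rightarrow>\<^sub>M prob_algebra (E1_space M MX Xs)"

definition sup_norm :: "'x set \<Rightarrow> ('x \<Rightarrow> real) \<Rightarrow> ennreal" where
  "sup_norm A g = (SUP x\<in>A. ennreal \<bar>g x\<bar>)"

text \<open>
  A norm on functions on \<open>A\<close>, with value \<open>\<infinity>\<close> off the linear space of functions on which it is defined.
  The first clause makes it a norm on functions with domain \<open>A\<close>, although HOL functions are total.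
\<close>

definition is_norm_on :: "'x set \<Rightarrow> (('x \<Rightarrow> real) \<Rightarrow> ennreal) \<Rightarrow> bool" where
  "is_norm_on A N \<longleftrightarrow>
     (\<forall>g h. (\<forall>x\<in>A. g x = h x) \<longrightarrow> N g = N h) \<and>
     (\<forall>g. N g = 0 \<longleftrightarrow> (\<forall>x\<in>A. g x = 0)) \<and>
     (\<forall>c g. N (\<lambda>x. c * g x) = ennreal \<bar>c\<bar> * N g) \<and>
     (\<forall>g h. N (\<lambda>x. g x + h x) \<le> N g + N h)"

definition tensor_square :: "('x \<Rightarrow> real) \<Rightarrow> 'w \<times> 'x \<times> 'x \<Rightarrow> real" where
  "tensor_square h = (\<lambda>(\<omega>, x, y). h x * h y)"

definition centered_square :: "('w \<Rightarrow> 'x measure) \<Rightarrow> ('x \<Rightarrow> real) \<Rightarrow> 'w \<times> 'x \<times> 'x \<Rightarrow> real" where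
  "centered_square m g = (\<lambda>(\<omega>, x, y). (g x - (\<integral>z. g z \<partial>m \<omega>)) * (g y - (\<integral>z. g z \<partial>m \<omega>)))"

definition in_Lp :: "'w measure \<Rightarrow> real \<Rightarrow> ('w \<Rightarrow> real) \<Rightarrow> bool" where
  "in_Lp M p R \<longleftrightarrow> R \<in> borel_measurable M \<and> integrable M (\<lambda>\<omega>. \<bar>R \<omega>\<bar> powr p)"

end

theory Submission
  imports Defs
begin

text \<open>
  Doubling the fibre variable turns a quenched correlation into an annealed second moment. Write
  \<open>a\<^sub>n(\<omega>) = \<integral> u\<^sub>n(\<omega>, x) dm\<^sub>\<omega>(x)\<close>, where \<open>u\<^sub>n(\<omega>, x)\<close> is \<open>g(x) h(f\<^sup>n\<^sub>\<omega> x)\<close>, or the same product with \<open>g\<close>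
  replaced by \<open>g - m\<^sub>\<omega>(g)\<close>. By Fubini on each fibre square,
  \<open>a\<^sub>n(\<omega>)\<^sup>2 = \<integral>\<integral> u\<^sub>n(\<omega>, x) u\<^sub>n(\<omega>, y) dm\<^sub>\<omega>(x) dm\<^sub>\<omega>(y)\<close>, and integrating over \<open>\<omega>\<close> gives exactly the
  correlation of the two-point motion \<open>F2\<close> that is assumed to decay
  (\<open>integral_mu_hat2_product\<close>). Hence \<open>\<integral> a\<^sub>n\<^sup>2 d\<mu> \<le> C \<zeta>\<^sup>n\<close>.

  The passage from this mean square bound to a bound for almost every \<open>\<omega>\<close>, simultaneously in \<open>n\<close>, with
  a factor in \<open>L\<^sup>p\<close>, is \<open>Lp_exponential_envelope\<close>. It uses that the \<open>a\<^sub>n\<close> are uniformly bounded: all higher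
  moments are then controlled by the second one, so that for some \<open>q > p\<close> and small \<open>c\<close> the sum over \<open>n\<close> of
  \<open>|a\<^sub>n|\<^sup>q e\<^sup>c\<^sup>q\<^sup>n\<close> is integrable, and its \<open>q\<close>-th root dominates every \<open>|a\<^sub>n| e\<^sup>c\<^sup>n\<close>.

  The rest is measurability: the family \<open>m\<^sub>\<omega> \<times> m\<^sub>\<omega>\<close> has to be shown to be a kernel, so that integrals over
  \<open>mu_hat2\<close> can be computed fibre by fibre (\<open>kernel_square\<close>).
\<close>

section \<open>From mean square decay to almost sure decay\<close>

text \<open>
  With \<open>q = p + 2\<close>, boundedness gives \<open>|a\<^sub>n|\<^sup>q \<le> K\<^sup>p a\<^sub>n\<^sup>2\<close>, so the sum \<open>s\<close> over \<open>n\<close> of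
  \<open>|a\<^sub>n|\<^sup>q e\<^sup>c\<^sup>q\<^sup>n\<close> is integrable as soon as \<open>\<zeta> e\<^sup>c\<^sup>q < 1\<close>. Each term is at most \<open>s\<close>, so \<open>R = s\<^sup>1\<^sup>/\<^sup>q\<close>
  is a suitable factor, and it lies in \<open>L\<^sup>p\<close> because \<open>p \<le> q\<close>.
\<close>

lemma (in prob_space) Lp_exponential_envelope:
  fixes a :: "nat \<Rightarrow> 'a \<Rightarrow> real"
  assumes meas[measurable]: "\<And>n. a n \<in> borel_measurable M"
    and bound: "\<And>n \<omega>. \<omega> \<in> space M \<Longrightarrow> \<bar>a n \<omega>\<bar> \<le> K"
    and second_moment: "\<And>n. (\<integral>\<omega>. (a n \<omega>)\<^sup>2 \<partial>M) \<le> C * \<zeta> ^ n"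
    and \<zeta>: "0 < \<zeta>" "\<zeta> < 1" and p: "1 \<le> p"
  shows "\<exists>c>0. \<exists>R. in_Lp M p R \<and> (AE \<omega> in M. \<forall>n. \<bar>a n \<omega>\<bar> \<le> R \<omega> * exp (- c * real n))"
proof -
  have K: "0 \<le> K"
    using not_empty bound[of _ 0] by force
  define q where "q = p + 2"
  have q: "0 < q" using p by (simp add: q_def)
  \<comment> \<open>This rate makes \<open>\<zeta> * exp (c * q)\<close> the square root of \<open>\<zeta>\<close>.\<close>
  define c where "c = - ln \<zeta> / (2 * q)"
  have c: "0 < c" using \<zeta> q by (simp add: c_def divide_neg_pos)
  define r where "r = \<zeta> * exp (c * q)"
  have r_eq: "r = exp (ln \<zeta> / 2)"
  proof -
    have "r = exp (ln \<zeta>) * exp (- ln \<zeta> / 2)"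
      using \<zeta> q by (simp add: r_def c_def)
    then show ?thesis by (simp flip: exp_add)
  qed
  have r: "0 < r" "r < 1" using \<zeta> by (auto simp: r_eq)
  define b where "b n \<omega> = \<bar>a n \<omega>\<bar> powr q * exp (c * q) ^ n" for n \<omega>
  have b_nonneg: "0 \<le> b n \<omega>" for n \<omega> by (simp add: b_def)
  have [measurable]: "b n \<in> borel_measurable M" for n
    unfolding b_def by measurable
  have b_le: "b n \<omega> \<le> K powr p * exp (c * q) ^ n * (a n \<omega>)\<^sup>2" if "\<omega> \<in> space M" for n \<omega>
  proof -
    have "\<bar>a n \<omega>\<bar> powr q = \<bar>a n \<omega>\<bar> powr p * \<bar>a n \<omega>\<bar> powr 2"
      by (simp add: q_def powr_add)
    also have "\<dots> = \<bar>a n \<omega>\<bar> powr p * (a n \<omega>)\<^sup>2"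
      by (cases "a n \<omega> = 0") (auto simp: powr_numeral)
    also have "\<dots> \<le> K powr p * (a n \<omega>)\<^sup>2"
      using bound[OF that, of n] p by (intro mult_right_mono powr_mono2) auto
    finally have "b n \<omega> \<le> (K powr p * (a n \<omega>)\<^sup>2) * exp (c * q) ^ n"
      unfolding b_def by (rule mult_right_mono) simp
    then show ?thesis by (simp add: mult_ac)
  qed
  have a2_int: "integrable M (\<lambda>\<omega>. (a n \<omega>)\<^sup>2)" for n
  proof (rule integrable_const_bound[where B = "K\<^sup>2"])
    show "AE \<omega> in M. norm ((a n \<omega>)\<^sup>2) \<le> K\<^sup>2"
      using bound K by (auto intro!: AE_I2 simp: abs_le_square_iff[symmetric])
  qed measurable
  have b_int: "(\<integral>\<^sup>+\<omega>. ennreal (b n \<omega>) \<partial>M) \<le> ennreal (K powr p * C * r ^ n)" for n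
  proof -
    have "(\<integral>\<^sup>+\<omega>. ennreal (b n \<omega>) \<partial>M)
        \<le> (\<integral>\<^sup>+\<omega>. ennreal (K powr p * exp (c * q) ^ n * (a n \<omega>)\<^sup>2) \<partial>M)"
      by (intro nn_integral_mono ennreal_leI b_le)
    also have "\<dots> = ennreal (K powr p * exp (c * q) ^ n * (\<integral>\<omega>. (a n \<omega>)\<^sup>2 \<partial>M))"
      by (subst nn_integral_eq_integral) (auto intro!: a2_int)
    also have "\<dots> \<le> ennreal (K powr p * exp (c * q) ^ n * (C * \<zeta> ^ n))"
      by (intro ennreal_leI mult_left_mono second_moment) auto
    also have "K powr p * exp (c * q) ^ n * (C * \<zeta> ^ n) = K powr p * C * r ^ n"
      by (simp add: r_def power_mult_distrib)
    finally show ?thesis .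
  qed
  have C: "0 \<le> C"
  proof -
    have "0 \<le> (\<integral>\<omega>. (a 0 \<omega>)\<^sup>2 \<partial>M)" by simp
    also have "\<dots> \<le> C" using second_moment[of 0] by simp
    finally show ?thesis .
  qed
  define S where "S \<omega> = (\<Sum>n. ennreal (b n \<omega>))" for \<omega>
  have [measurable]: "S \<in> borel_measurable M" unfolding S_def by measurable
  have "(\<integral>\<^sup>+\<omega>. S \<omega> \<partial>M) = (\<Sum>n. \<integral>\<^sup>+\<omega>. ennreal (b n \<omega>) \<partial>M)"
    unfolding S_def by (rule nn_integral_suminf) measurable
  also have "\<dots> \<le> (\<Sum>n. ennreal (K powr p * C * r ^ n))"
    by (intro suminf_le b_int) auto
  also have "\<dots> = ennreal (\<Sum>n. K powr p * C * r ^ n)"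
    using C r by (intro suminf_ennreal2) (auto intro!: summable_mult summable_geometric)
  finally have S_finite: "(\<integral>\<^sup>+\<omega>. S \<omega> \<partial>M) < \<infinity>"
    by (rule le_less_trans) simp
  have S_AE: "AE \<omega> in M. S \<omega> \<noteq> \<infinity>"
    using S_finite by (intro nn_integral_PInf_AE) auto
  define s where "s \<omega> = enn2real (S \<omega>)" for \<omega>
  have [measurable]: "s \<in> borel_measurable M" unfolding s_def by measurable
  have s_nonneg: "0 \<le> s \<omega>" for \<omega> by (simp add: s_def)
  have s_int: "integrable M s"
  proof (rule integrableI_bounded)
    have "(\<integral>\<^sup>+\<omega>. ennreal (norm (s \<omega>)) \<partial>M) \<le> (\<integral>\<^sup>+\<omega>. S \<omega> \<partial>M)"
      by (intro nn_integral_mono) (simp add: s_def ennreal_enn2real_if)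
    then show "(\<integral>\<^sup>+\<omega>. ennreal (norm (s \<omega>)) \<partial>M) < \<infinity>"
      using S_finite by (rule le_less_trans)
  qed measurable
  define R where "R \<omega> = s \<omega> powr (1 / q)" for \<omega>
  have "in_Lp M p R"
    unfolding in_Lp_def
  proof
    show R_meas[measurable]: "R \<in> borel_measurable M" unfolding R_def by measurable
    show "integrable M (\<lambda>\<omega>. \<bar>R \<omega>\<bar> powr p)"
    proof (rule Bochner_Integration.integrable_bound)
      show "integrable M (\<lambda>\<omega>. 1 + s \<omega>)" using s_int by simp
      have "\<bar>R \<omega>\<bar> powr p \<le> 1 + s \<omega>" for \<omega>
      proof (cases "s \<omega> \<le> 1")
        case True
        have "s \<omega> powr (p / q) \<le> 1"
          using powr_mono2[OF _ s_nonneg True, of "p / q"] p q by simp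
        then show ?thesis using s_nonneg[of \<omega>] by (simp add: R_def powr_powr)
      next
        case False
        have "s \<omega> powr (p / q) \<le> s \<omega> powr 1"
          using False p by (intro powr_mono) (auto simp: q_def)
        then show ?thesis using False by (simp add: R_def powr_powr)
      qed
      then show "AE \<omega> in M. norm (\<bar>R \<omega>\<bar> powr p) \<le> norm (1 + s \<omega>)"
        using s_nonneg by (auto intro!: AE_I2 intro: order_trans)
    qed measurable
  qed
  moreover have "AE \<omega> in M. \<forall>n. \<bar>a n \<omega>\<bar> \<le> R \<omega> * exp (- c * real n)"
    using S_AE
  proof eventually_elim
    fix \<omega> assume fin: "S \<omega> \<noteq> \<infinity>"
    show "\<forall>n. \<bar>a n \<omega>\<bar> \<le> R \<omega> * exp (- c * real n)"
    proof
      fix n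
      have "ennreal (b n \<omega>) \<le> S \<omega>"
        unfolding S_def using sum_le_suminf[of "\<lambda>n. ennreal (b n \<omega>)" "{n}"] by simp
      then have "b n \<omega> \<le> s \<omega>"
        unfolding s_def using enn2real_mono[of "ennreal (b n \<omega>)" "S \<omega>"] fin b_nonneg[of n \<omega>]
        by (simp add: less_top)
      then have "b n \<omega> powr (1 / q) \<le> R \<omega>"
        unfolding R_def using q by (intro powr_mono2 b_nonneg) auto
      moreover have "b n \<omega> powr (1 / q) = \<bar>a n \<omega>\<bar> * exp (c * real n)"
      proof -
        have "exp (c * q) ^ n = exp (c * real n) powr q"
          by (simp add: exp_powr_real mult_ac exp_of_nat_mult[symmetric])
        then have "b n \<omega> = (\<bar>a n \<omega>\<bar> * exp (c * real n)) powr q"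
          by (simp add: b_def powr_mult)
        then show ?thesis
          using q by (simp only: powr_powr) simp
      qed
      ultimately show "\<bar>a n \<omega>\<bar> \<le> R \<omega> * exp (- c * real n)"
        by (simp add: exp_minus field_simps)
    qed
  qed
  ultimately show ?thesis using c by blast
qed

section \<open>Measurability on the bundles of fibres and of fibre squares\<close>

lemma F1_funpow: "(F1 T f ^^ n) (\<omega>, x) = ((T ^^ n) \<omega>, fiter T f n \<omega> x)"
  by (induction n) (auto simp: F1_def)

lemma F2_funpow:
  "(F2 T f ^^ n) (\<omega>, x, y) = ((T ^^ n) \<omega>, fiter T f n \<omega> x, fiter T f n \<omega> y)"
  by (induction n) (auto simp: F2_def)

context random_system
begin

abbreviation "\<E>\<^sub>1 \<equiv> E1_space M MX Xs"
abbreviation "\<E>\<^sub>2 \<equiv> E2_space M MX Xs"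

lemma space_E1_space: "space \<E>\<^sub>1 = E1 M Xs"
  using fibre_subset by (auto simp: E1_space_def space_restrict_space E1_def space_pair_measure)

lemma space_E2_space: "space \<E>\<^sub>2 = E2 M Xs"
  using fibre_subset by (auto simp: E2_space_def space_restrict_space E2_def space_pair_measure)

lemma space_fibre: "\<omega> \<in> space M \<Longrightarrow> space (m \<omega>) = Xs \<omega>"
  using sets_eq_imp_space_eq[OF fibre_sets] fibre_subset by (auto simp: space_restrict_space)

lemma E2_measurable: "E2 M Xs \<in> sets (M \<Otimes>\<^sub>M (MX \<Otimes>\<^sub>M MX))"
proof -
  note [measurable] = E1_measurable
  have "E2 M Xs = {q \<in> space (M \<Otimes>\<^sub>M (MX \<Otimes>\<^sub>M MX)).
      (fst q, fst (snd q)) \<in> E1 M Xs \<and> (fst q, snd (snd q)) \<in> E1 M Xs}"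
    using fibre_subset by (auto simp: E1_def E2_def space_pair_measure)
  also have "\<dots> \<in> sets (M \<Otimes>\<^sub>M (MX \<Otimes>\<^sub>M MX))" by measurable
  finally show ?thesis .
qed

lemma measurable_fst_E1 [measurable]: "fst \<in> \<E>\<^sub>1 \<rightarrow>\<^sub>M M"
  unfolding E1_space_def by (intro measurable_restrict_space1) measurable

lemma measurable_snd_E1 [measurable]: "snd \<in> \<E>\<^sub>1 \<rightarrow>\<^sub>M MX"
  unfolding E1_space_def by (intro measurable_restrict_space1) measurable

lemma measurable_E2_to_E1 [measurable]:
  "(\<lambda>q. (fst q, fst (snd q))) \<in> \<E>\<^sub>2 \<rightarrow>\<^sub>M \<E>\<^sub>1"
  "(\<lambda>q. (fst q, snd (snd q))) \<in> \<E>\<^sub>2 \<rightarrow>\<^sub>M \<E>\<^sub>1"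
proof -
  show "(\<lambda>q. (fst q, fst (snd q))) \<in> \<E>\<^sub>2 \<rightarrow>\<^sub>M \<E>\<^sub>1"
    unfolding E1_space_def
  proof (rule measurable_restrict_space2)
    show "(\<lambda>q. (fst q, fst (snd q))) \<in> space \<E>\<^sub>2 \<rightarrow> E1 M Xs"
      by (auto simp: space_E2_space E2_def E1_def)
    show "(\<lambda>q. (fst q, fst (snd q))) \<in> \<E>\<^sub>2 \<rightarrow>\<^sub>M M \<Otimes>\<^sub>M MX"
      unfolding E2_space_def by (intro measurable_restrict_space1) measurable
  qed
  show "(\<lambda>q. (fst q, snd (snd q))) \<in> \<E>\<^sub>2 \<rightarrow>\<^sub>M \<E>\<^sub>1"
    unfolding E1_space_def
  proof (rule measurable_restrict_space2)
    show "(\<lambda>q. (fst q, snd (snd q))) \<in> space \<E>\<^sub>2 \<rightarrow> E1 M Xs"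
      by (auto simp: space_E2_space E2_def E1_def)
    show "(\<lambda>q. (fst q, snd (snd q))) \<in> \<E>\<^sub>2 \<rightarrow>\<^sub>M M \<Otimes>\<^sub>M MX"
      unfolding E2_space_def by (intro measurable_restrict_space1) measurable
  qed
qed

text \<open>
  The cocycle is the second component of the iterates of the skew product \<open>F1\<close>, from which it inherits
  joint measurability in \<open>(\<omega>, x)\<close>.
\<close>

lemma measurable_fiter:
  "(\<lambda>q. fiter T f n (fst q) (snd q)) \<in> \<E>\<^sub>1 \<rightarrow>\<^sub>M MX"
proof -
  have "(F1 T f ^^ n) \<in> \<E>\<^sub>1 \<rightarrow>\<^sub>M \<E>\<^sub>1"
    using F1_measurable by (rule measurable_compose_n)
  then have "(\<lambda>q. snd ((F1 T f ^^ n) q)) \<in> \<E>\<^sub>1 \<rightarrow>\<^sub>M MX" by measurable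
  moreover have "snd ((F1 T f ^^ n) q) = fiter T f n (fst q) (snd q)" for q
    using F1_funpow[of n T f "fst q" "snd q"] by simp
  ultimately show ?thesis by simp
qed

lemma measurable_Pair_fibre:
  assumes \<omega>: "\<omega> \<in> space M"
  shows "Pair \<omega> \<in> m \<omega> \<rightarrow>\<^sub>M \<E>\<^sub>1"
  unfolding E1_space_def
proof (rule measurable_restrict_space2)
  show "Pair \<omega> \<in> space (m \<omega>) \<rightarrow> E1 M Xs"
    using \<omega> by (auto simp: space_fibre E1_def)
  have "(\<lambda>x. x) \<in> restrict_space MX (Xs \<omega>) \<rightarrow>\<^sub>M MX"
    by (intro measurable_restrict_space1) measurable
  then have "(\<lambda>x. x) \<in> m \<omega> \<rightarrow>\<^sub>M MX"
    using fibre_sets[OF \<omega>] by (simp cong: measurable_cong_sets)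
  then show "Pair \<omega> \<in> m \<omega> \<rightarrow>\<^sub>M M \<Otimes>\<^sub>M MX"
    using \<omega> by (intro measurable_Pair) auto
qed

section \<open>Integration over fibres\<close>

lemma measurable_fibre_integral:
  assumes u[measurable]: "u \<in> borel_measurable \<E>\<^sub>1"
  shows "(\<lambda>\<omega>. \<integral>x. u (\<omega>, x) \<partial>m \<omega> :: real) \<in> borel_measurable M"
proof -
  have "(\<lambda>\<omega>. \<integral>q. u q \<partial>distr (m \<omega>) \<E>\<^sub>1 (\<lambda>x. (\<omega>, x))) \<in> borel_measurable M"
    by (rule measurable_compose[OF measurable_prob_algebraD[OF kernel]
          integral_measurable_subprob_algebra[OF u]])
  also have "?this \<longleftrightarrow> ?thesis"
    by (intro measurable_cong integral_distr measurable_Pair_fibre u)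
  finally show ?thesis .
qed

lemma integrable_fibre:
  assumes u: "u \<in> borel_measurable \<E>\<^sub>1" and bound: "\<And>q. q \<in> E1 M Xs \<Longrightarrow> \<bar>u q\<bar> \<le> (K::real)"
    and \<omega>: "\<omega> \<in> space M"
  shows "integrable (m \<omega>) (\<lambda>x. u (\<omega>, x))"
proof -
  interpret fibre: prob_space "m \<omega>" using fibre_prob[OF \<omega>] .
  show ?thesis
  proof (rule fibre.integrable_const_bound[where B = K])
    show "AE x in m \<omega>. norm (u (\<omega>, x)) \<le> K"
      using bound \<omega> by (auto intro!: AE_I2 simp: space_fibre E1_def)
    show "(\<lambda>x. u (\<omega>, x)) \<in> borel_measurable (m \<omega>)"
      using measurable_compose[OF measurable_Pair_fibre[OF \<omega>] u] .
  qed
qed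

lemma abs_fibre_integral_le:
  assumes u: "u \<in> borel_measurable \<E>\<^sub>1" and bound: "\<And>q. q \<in> E1 M Xs \<Longrightarrow> \<bar>u q\<bar> \<le> (K::real)"
    and \<omega>: "\<omega> \<in> space M"
  shows "\<bar>\<integral>x. u (\<omega>, x) \<partial>m \<omega>\<bar> \<le> K"
proof -
  interpret fibre: prob_space "m \<omega>" using fibre_prob[OF \<omega>] .
  have bnd: "\<bar>u (\<omega>, x)\<bar> \<le> K" if "x \<in> space (m \<omega>)" for x
    using bound \<omega> that by (auto simp: space_fibre E1_def)
  have "\<bar>\<integral>x. u (\<omega>, x) \<partial>m \<omega>\<bar> \<le> (\<integral>x. \<bar>u (\<omega>, x)\<bar> \<partial>m \<omega>)"
    by (rule integral_abs_bound)
  also have "\<dots> \<le> (\<integral>x. K \<partial>m \<omega>)"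
    using integrable_fibre[OF u bound \<omega>] bnd by (intro integral_mono) auto
  finally show ?thesis by (simp add: fibre.prob_space)
qed

lemma measurable_fibre_square:
  assumes \<omega>: "\<omega> \<in> space M"
  shows "(\<lambda>(x, y). (\<omega>, x, y)) \<in> m \<omega> \<Otimes>\<^sub>M m \<omega> \<rightarrow>\<^sub>M \<E>\<^sub>2"
  unfolding E2_space_def
proof (rule measurable_restrict_space2)
  show "(\<lambda>(x, y). (\<omega>, x, y)) \<in> space (m \<omega> \<Otimes>\<^sub>M m \<omega>) \<rightarrow> E2 M Xs"
    using \<omega> by (auto simp: space_fibre E2_def space_pair_measure)
  have [measurable]: "(\<lambda>x. x) \<in> m \<omega> \<rightarrow>\<^sub>M MX"
    using measurable_compose[OF measurable_Pair_fibre[OF \<omega>] measurable_snd_E1] by simp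
  show "(\<lambda>(x, y). (\<omega>, x, y)) \<in> m \<omega> \<Otimes>\<^sub>M m \<omega> \<rightarrow>\<^sub>M M \<Otimes>\<^sub>M (MX \<Otimes>\<^sub>M MX)"
    unfolding case_prod_beta using \<omega>
    by (intro measurable_Pair measurable_const)
      (auto intro: measurable_compose[OF measurable_fst] measurable_compose[OF measurable_snd])
qed

section \<open>The two-point measure\<close>

text \<open>
  The product of the given kernel on \<open>E1\<close> with itself is a kernel on \<open>E1 \<times> E1\<close>. It charges only pairs
  of points over the same \<open>\<omega>\<close>, so pushing it forward along \<open>((\<omega>, x), (\<omega>', y)) \<mapsto> (\<omega>, x, y)\<close> gives the family
  in question. Over different base points this map may leave \<open>E2\<close>; there it is redirected to an
  arbitrary point of \<open>E2\<close>, which changes nothing on the support.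
\<close>

lemma kernel_square:
  "(\<lambda>\<omega>. distr (m \<omega> \<Otimes>\<^sub>M m \<omega>) \<E>\<^sub>2 (\<lambda>(x, y). (\<omega>, x, y))) \<in> M \<rightarrow>\<^sub>M prob_algebra \<E>\<^sub>2"
proof -
  obtain \<omega>0 where \<omega>0: "\<omega>0 \<in> space M" using not_empty by blast
  obtain x0 where "x0 \<in> Xs \<omega>0"
    using prob_space.not_empty[OF fibre_prob[OF \<omega>0]] space_fibre[OF \<omega>0] by auto
  then have e0: "(\<omega>0, x0, x0) \<in> E2 M Xs" using \<omega>0 by (simp add: E2_def)
  define K where "K \<omega> = distr (m \<omega>) \<E>\<^sub>1 (\<lambda>x. (\<omega>, x))" for \<omega>
  define join where "join p = (fst (fst p), snd (fst p), snd (snd p))" for p :: "('w \<times> 'x) \<times> 'w \<times> 'x"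
  define J where "J p = (if join p \<in> E2 M Xs then join p else (\<omega>0, x0, x0))" for p
  have join[measurable]: "join \<in> \<E>\<^sub>1 \<Otimes>\<^sub>M \<E>\<^sub>1 \<rightarrow>\<^sub>M M \<Otimes>\<^sub>M (MX \<Otimes>\<^sub>M MX)"
    unfolding join_def by measurable
  have J: "J \<in> \<E>\<^sub>1 \<Otimes>\<^sub>M \<E>\<^sub>1 \<rightarrow>\<^sub>M \<E>\<^sub>2"
    unfolding E2_space_def
  proof (rule measurable_restrict_space2)
    show "J \<in> space (\<E>\<^sub>1 \<Otimes>\<^sub>M \<E>\<^sub>1) \<rightarrow> E2 M Xs"
      using e0 by (auto simp: J_def)
    have "(\<omega>0, x0, x0) \<in> space (M \<Otimes>\<^sub>M (MX \<Otimes>\<^sub>M MX))"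
      using e0 sets.sets_into_space[OF E2_measurable] by blast
    then show "J \<in> \<E>\<^sub>1 \<Otimes>\<^sub>M \<E>\<^sub>1 \<rightarrow>\<^sub>M M \<Otimes>\<^sub>M (MX \<Otimes>\<^sub>M MX)"
      unfolding J_def
      using E2_measurable by measurable
  qed
  have K: "K \<in> M \<rightarrow>\<^sub>M prob_algebra \<E>\<^sub>1" using kernel by (simp add: K_def[abs_def])
  have "(\<lambda>\<omega>. distr (K \<omega> \<Otimes>\<^sub>M K \<omega>) \<E>\<^sub>2 J) \<in> M \<rightarrow>\<^sub>M prob_algebra \<E>\<^sub>2"
    by (rule measurable_compose[OF measurable_pair_prob[OF K K] measurable_distr_prob_space[OF J]])
  also have "?this \<longleftrightarrow> ?thesis"
  proof (rule measurable_cong)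
    fix \<omega> assume \<omega>: "\<omega> \<in> space M"
    note Pair_\<omega> = measurable_Pair_fibre[OF \<omega>]
    interpret fibre: prob_space "m \<omega>" using fibre_prob[OF \<omega>] .
    have "K \<omega> \<Otimes>\<^sub>M K \<omega> = distr (m \<omega> \<Otimes>\<^sub>M m \<omega>) (\<E>\<^sub>1 \<Otimes>\<^sub>M \<E>\<^sub>1) (\<lambda>(x, y). ((\<omega>, x), (\<omega>, y)))"
      unfolding K_def
      by (intro pair_measure_distr Pair_\<omega> prob_space_imp_sigma_finite fibre.prob_space_distr)
    also have "distr \<dots> \<E>\<^sub>2 J
        = distr (m \<omega> \<Otimes>\<^sub>M m \<omega>) \<E>\<^sub>2 (J \<circ> (\<lambda>(x, y). ((\<omega>, x), (\<omega>, y))))"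
    proof (rule distr_distr[OF J])
      show "(\<lambda>(x, y). ((\<omega>, x), (\<omega>, y))) \<in> m \<omega> \<Otimes>\<^sub>M m \<omega> \<rightarrow>\<^sub>M \<E>\<^sub>1 \<Otimes>\<^sub>M \<E>\<^sub>1"
        using Pair_\<omega> by measurable
    qed
    also have "\<dots> = distr (m \<omega> \<Otimes>\<^sub>M m \<omega>) \<E>\<^sub>2 (\<lambda>(x, y). (\<omega>, x, y))"
      using \<omega> by (intro distr_cong)
        (auto simp: J_def join_def E2_def space_pair_measure space_fibre)
    finally show "distr (K \<omega> \<Otimes>\<^sub>M K \<omega>) \<E>\<^sub>2 J = distr (m \<omega> \<Otimes>\<^sub>M m \<omega>) \<E>\<^sub>2 (\<lambda>(x, y). (\<omega>, x, y))" .
  qed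
  finally show ?thesis .
qed

text \<open>
  On each fibre square the integrand is a product of a function of \<open>x\<close> and the same function of \<open>y\<close>, so
  Fubini makes its integral a square.
\<close>

lemma integral_mu_hat2_product:
  fixes u :: "'w \<times> 'x \<Rightarrow> real"
  assumes u[measurable]: "u \<in> borel_measurable \<E>\<^sub>1" and bound: "\<And>q. q \<in> E1 M Xs \<Longrightarrow> \<bar>u q\<bar> \<le> K"
  shows "(\<integral>(\<omega>, x, y). u (\<omega>, x) * u (\<omega>, y) \<partial>mu_hat2 M MX Xs m) = (\<integral>\<omega>. (\<integral>x. u (\<omega>, x) \<partial>m \<omega>)\<^sup>2 \<partial>M)"
proof -
  let ?v = "\<lambda>(\<omega>, x, y). u (\<omega>, x) * u (\<omega>, y)"
  let ?L = "\<lambda>\<omega>. distr (m \<omega> \<Otimes>\<^sub>M m \<omega>) \<E>\<^sub>2 (\<lambda>(x, y). (\<omega>, x, y))"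
  have v: "?v \<in> borel_measurable \<E>\<^sub>2"
    unfolding case_prod_beta
    by (intro borel_measurable_times measurable_compose[OF measurable_E2_to_E1(1) u]
        measurable_compose[OF measurable_E2_to_E1(2) u])
  have v_bound: "\<bar>?v q\<bar> \<le> K * K" if "q \<in> E2 M Xs" for q
  proof -
    obtain \<omega> x y where q: "q = (\<omega>, x, y)" by (cases q)
    have "\<bar>u (\<omega>, x)\<bar> * \<bar>u (\<omega>, y)\<bar> \<le> K * K"
      using that order_trans[OF abs_ge_zero bound] unfolding q
      by (intro mult_mono bound) (auto simp: E1_def E2_def)
    then show ?thesis by (simp add: q abs_mult)
  qed
  have "(\<integral>q. ?v q \<partial>mu_hat2 M MX Xs m) = (\<integral>\<omega>. \<integral>q. ?v q \<partial>?L \<omega> \<partial>M)"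
    unfolding mu_hat2_def
  proof (rule integral_bind[where B = "K * K" and B' = 1])
    show "AE \<omega> in M. emeasure (?L \<omega>) (space (?L \<omega>)) \<le> ennreal 1"
      using measurable_space[OF kernel_square]
      by (auto intro!: AE_I2 prob_space.measure_le_1 simp: space_prob_algebra prob_space.emeasure_space_1)
  qed (use v v_bound measurable_prob_algebraD[OF kernel_square] in
      \<open>auto simp: space_E2_space finite_measure_axioms\<close>)
  also have "\<dots> = (\<integral>\<omega>. (\<integral>x. u (\<omega>, x) \<partial>m \<omega>)\<^sup>2 \<partial>M)"
  proof (rule Bochner_Integration.integral_cong[OF refl])
    fix \<omega> assume \<omega>: "\<omega> \<in> space M"
    interpret fibre: prob_space "m \<omega>" using fibre_prob[OF \<omega>] .
    interpret square: pair_prob_space "m \<omega>" "m \<omega>" ..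
    have "(\<integral>q. ?v q \<partial>?L \<omega>) = (\<integral>z. ?v (case z of (x, y) \<Rightarrow> (\<omega>, x, y)) \<partial>(m \<omega> \<Otimes>\<^sub>M m \<omega>))"
      by (rule integral_distr[OF measurable_fibre_square[OF \<omega>] v])
    also have "\<dots> = (\<integral>x. \<integral>y. u (\<omega>, x) * u (\<omega>, y) \<partial>m \<omega> \<partial>m \<omega>)"
    proof (subst square.integral_fst'[symmetric])
      show "integrable (m \<omega> \<Otimes>\<^sub>M m \<omega>) (\<lambda>z. ?v (case z of (x, y) \<Rightarrow> (\<omega>, x, y)))"
      proof (rule square.P.integrable_const_bound[where B = "K * K"])
        show "AE z in m \<omega> \<Otimes>\<^sub>M m \<omega>. norm (?v (case z of (x, y) \<Rightarrow> (\<omega>, x, y))) \<le> K * K"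
          using measurable_space[OF measurable_fibre_square[OF \<omega>]] v_bound
          by (intro AE_I2) (simp only: real_norm_def space_E2_space)
        show "(\<lambda>z. ?v (case z of (x, y) \<Rightarrow> (\<omega>, x, y))) \<in> borel_measurable (m \<omega> \<Otimes>\<^sub>M m \<omega>)"
          by (rule measurable_compose[OF measurable_fibre_square[OF \<omega>] v])
      qed
    qed simp
    also have "\<dots> = (\<integral>x. u (\<omega>, x) \<partial>m \<omega>)\<^sup>2"
      by (simp add: power2_eq_square)
    finally show "(\<integral>q. ?v q \<partial>?L \<omega>) = (\<integral>x. u (\<omega>, x) \<partial>m \<omega>)\<^sup>2" .
  qed
  finally show ?thesis .
qed

section \<open>Quenched decay of correlations\<close>

lemma fibre_integral_decay:
  fixes u :: "nat \<Rightarrow> 'w \<times> 'x \<Rightarrow> real"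
  assumes u: "\<And>n. u n \<in> borel_measurable \<E>\<^sub>1"
    and bound: "\<And>n q. q \<in> E1 M Xs \<Longrightarrow> \<bar>u n q\<bar> \<le> K"
    and decay: "\<And>n. \<bar>\<integral>(\<omega>, x, y). u n (\<omega>, x) * u n (\<omega>, y) \<partial>mu_hat2 M MX Xs m\<bar> \<le> C * \<zeta> ^ n"
    and "0 < \<zeta>" "\<zeta> < 1" "1 \<le> p"
  shows "\<exists>c>0. \<exists>R. in_Lp M p R \<and>
    (AE \<omega> in M. \<forall>n. \<bar>\<integral>x. u n (\<omega>, x) \<partial>m \<omega>\<bar> \<le> R \<omega> * exp (- c * real n))"
proof (rule Lp_exponential_envelope)
  show "(\<lambda>\<omega>. \<integral>x. u n (\<omega>, x) \<partial>m \<omega>) \<in> borel_measurable M" for n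
    by (rule measurable_fibre_integral[OF u])
  show "\<bar>\<integral>x. u n (\<omega>, x) \<partial>m \<omega>\<bar> \<le> K" if "\<omega> \<in> space M" for n \<omega>
    by (rule abs_fibre_integral_le[OF u bound that])
  show "(\<integral>\<omega>. (\<integral>x. u n (\<omega>, x) \<partial>m \<omega>)\<^sup>2 \<partial>M) \<le> C * \<zeta> ^ n" for n
    using decay[of n] integral_mu_hat2_product[OF u[of n] bound[of _ n]] by simp
qed fact+

lemma measurable_observable_orbit [measurable]:
  assumes "h \<in> borel_measurable MX"
  shows "(\<lambda>q. h (fiter T f n (fst q) (snd q))) \<in> borel_measurable \<E>\<^sub>1"
  using measurable_compose[OF measurable_fiter assms] .

lemma orbit_in_space:
  assumes "q \<in> E1 M Xs"
  shows "snd q \<in> space MX" and "fiter T f n (fst q) (snd q) \<in> space MX"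
  using assms measurable_space[OF measurable_snd_E1] measurable_space[OF measurable_fiter]
  by (auto simp: space_E1_space)

lemma fibre_correlation_decay:
  assumes g[measurable]: "g \<in> borel_measurable MX" and h[measurable]: "h \<in> borel_measurable MX"
    and g_le: "\<And>x. x \<in> space MX \<Longrightarrow> \<bar>g x\<bar> \<le> 1" and h_le: "\<And>x. x \<in> space MX \<Longrightarrow> \<bar>h x\<bar> \<le> 1"
    and decay: "\<And>n. \<bar>\<integral>q. tensor_square g q * tensor_square h ((F2 T f ^^ n) q) \<partial>mu_hat2 M MX Xs m\<bar>
      \<le> C * \<zeta> ^ n"
    and \<zeta>: "0 < \<zeta>" "\<zeta> < 1" and p: "1 \<le> p"
  shows "\<exists>c>0. \<exists>R. in_Lp M p R \<and>
    (AE \<omega> in M. \<forall>n. \<bar>\<integral>x. g x * h (fiter T f n \<omega> x) \<partial>m \<omega>\<bar> \<le> R \<omega> * exp (- c * real n))"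
proof -
  define u where "u n q = g (snd q) * h (fiter T f n (fst q) (snd q))" for n q
  have "\<exists>c>0. \<exists>R. in_Lp M p R \<and>
    (AE \<omega> in M. \<forall>n. \<bar>\<integral>x. u n (\<omega>, x) \<partial>m \<omega>\<bar> \<le> R \<omega> * exp (- c * real n))"
  proof (rule fibre_integral_decay)
    show "u n \<in> borel_measurable \<E>\<^sub>1" for n
      unfolding u_def by measurable
    show "\<bar>u n q\<bar> \<le> 1" if "q \<in> E1 M Xs" for n q
      using g_le h_le orbit_in_space[OF that] by (auto simp: u_def abs_mult intro: mult_le_one)
    have "tensor_square g q * tensor_square h ((F2 T f ^^ n) q)
        = (case q of (\<omega>, x, y) \<Rightarrow> u n (\<omega>, x) * u n (\<omega>, y))" for n q
      by (cases q) (simp add: F2_funpow tensor_square_def u_def)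
    then show "\<bar>\<integral>(\<omega>, x, y). u n (\<omega>, x) * u n (\<omega>, y) \<partial>mu_hat2 M MX Xs m\<bar> \<le> C * \<zeta> ^ n" for n
      using decay by simp
  qed fact+
  then show ?thesis by (simp add: u_def)
qed

text \<open>
  The covariance is the fibre integral of \<open>(g - m\<^sub>\<omega>(g)) h \<circ> f\<^sup>n\<^sub>\<omega>\<close>, and the product of two copies of this
  function is the observable \<open>centered_square\<close> paired with \<open>tensor_square\<close> along \<open>F2\<close>. Centring doubles the
  uniform bound.
\<close>

lemma fibre_covariance_decay:
  assumes g[measurable]: "g \<in> borel_measurable MX" and h[measurable]: "h \<in> borel_measurable MX"
    and g_le: "\<And>x. x \<in> space MX \<Longrightarrow> \<bar>g x\<bar> \<le> 1" and h_le: "\<And>x. x \<in> space MX \<Longrightarrow> \<bar>h x\<bar> \<le> 1"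
    and decay: "\<And>n. \<bar>\<integral>q. centered_square m g q * tensor_square h ((F2 T f ^^ n) q) \<partial>mu_hat2 M MX Xs m\<bar>
      \<le> C * \<zeta> ^ n"
    and \<zeta>: "0 < \<zeta>" "\<zeta> < 1" and p: "1 \<le> p"
  shows "\<exists>c>0. \<exists>R. in_Lp M p R \<and>
    (AE \<omega> in M. \<forall>n.
      \<bar>(\<integral>x. g x * h (fiter T f n \<omega> x) \<partial>m \<omega>)
         - (\<integral>x. g x \<partial>m \<omega>) * (\<integral>x. h (fiter T f n \<omega> x) \<partial>m \<omega>)\<bar>
      \<le> R \<omega> * exp (- c * real n))"
proof -
  have g_snd: "(\<lambda>q. g (snd q)) \<in> borel_measurable \<E>\<^sub>1" by measurable
  have g_snd_le: "\<bar>g (snd q)\<bar> \<le> 1" if "q \<in> E1 M Xs" for q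
    using g_le orbit_in_space(1)[OF that] .
  have mean_meas[measurable]: "(\<lambda>\<omega>. \<integral>z. g z \<partial>m \<omega>) \<in> borel_measurable M"
    using measurable_fibre_integral[OF g_snd] by simp
  have mean_le: "\<bar>\<integral>z. g z \<partial>m \<omega>\<bar> \<le> 1" if "\<omega> \<in> space M" for \<omega>
    using abs_fibre_integral_le[OF g_snd g_snd_le that] by simp
  define u where
    "u n q = (g (snd q) - (\<integral>z. g z \<partial>m (fst q))) * h (fiter T f n (fst q) (snd q))" for n q
  have "\<exists>c>0. \<exists>R. in_Lp M p R \<and>
    (AE \<omega> in M. \<forall>n. \<bar>\<integral>x. u n (\<omega>, x) \<partial>m \<omega>\<bar> \<le> R \<omega> * exp (- c * real n))"
  proof (rule fibre_integral_decay)
    show "u n \<in> borel_measurable \<E>\<^sub>1" for n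
      unfolding u_def by measurable
    show "\<bar>u n q\<bar> \<le> 2" if q: "q \<in> E1 M Xs" for n q
    proof -
      have "\<bar>g (snd q) - (\<integral>z. g z \<partial>m (fst q))\<bar> \<le> 2"
        using g_snd_le[OF q] mean_le[of "fst q"] q by (auto simp: E1_def)
      moreover have "\<bar>h (fiter T f n (fst q) (snd q))\<bar> \<le> 1"
        using h_le orbit_in_space(2)[OF q] .
      ultimately have "\<bar>u n q\<bar> \<le> 2 * 1"
        unfolding u_def abs_mult by (rule mult_mono) simp_all
      then show ?thesis by simp
    qed
    have "centered_square m g q * tensor_square h ((F2 T f ^^ n) q)
        = (case q of (\<omega>, x, y) \<Rightarrow> u n (\<omega>, x) * u n (\<omega>, y))" for n q
      by (cases q) (simp add: F2_funpow centered_square_def tensor_square_def u_def)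
    then show "\<bar>\<integral>(\<omega>, x, y). u n (\<omega>, x) * u n (\<omega>, y) \<partial>mu_hat2 M MX Xs m\<bar> \<le> C * \<zeta> ^ n" for n
      using decay by simp
  qed fact+
  then obtain c R where c: "0 < c" and R: "in_Lp M p R"
    and u_le: "AE \<omega> in M. \<forall>n. \<bar>\<integral>x. u n (\<omega>, x) \<partial>m \<omega>\<bar> \<le> R \<omega> * exp (- c * real n)"
    by blast
  have u_integral: "(\<integral>x. u n (\<omega>, x) \<partial>m \<omega>)
      = (\<integral>x. g x * h (fiter T f n \<omega> x) \<partial>m \<omega>)
        - (\<integral>x. g x \<partial>m \<omega>) * (\<integral>x. h (fiter T f n \<omega> x) \<partial>m \<omega>)"
    if \<omega>: "\<omega> \<in> space M" for n \<omega>
  proof -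
    have "integrable (m \<omega>) (\<lambda>x. h (fiter T f n \<omega> x))"
      using integrable_fibre[OF measurable_observable_orbit[OF h] _ \<omega>, of n 1]
        h_le orbit_in_space(2) by simp
    moreover have "integrable (m \<omega>) (\<lambda>x. g x * h (fiter T f n \<omega> x))"
      using integrable_fibre[of "\<lambda>q. g (snd q) * h (fiter T f n (fst q) (snd q))" 1, OF _ _ \<omega>]
        g_le h_le orbit_in_space by (simp add: abs_mult mult_le_one)
    ultimately show ?thesis
      by (simp add: u_def left_diff_distrib)
  qed
  have "AE \<omega> in M. \<forall>n.
      \<bar>(\<integral>x. g x * h (fiter T f n \<omega> x) \<partial>m \<omega>)
         - (\<integral>x. g x \<partial>m \<omega>) * (\<integral>x. h (fiter T f n \<omega> x) \<partial>m \<omega>)\<bar>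
      \<le> R \<omega> * exp (- c * real n)"
    using u_le AE_space by eventually_elim (simp add: u_integral)
  with c R show ?thesis by blast
qed

end

lemma abs_le_1_if_sup_norm_le_1:
  assumes "sup_norm A g \<le> 1" "x \<in> A"
  shows "\<bar>g x\<bar> \<le> 1"
proof -
  have "ennreal \<bar>g x\<bar> \<le> sup_norm A g"
    unfolding sup_norm_def using assms(2) by (rule SUP_upper)
  also note assms(1)
  finally show ?thesis by simp
qed

theorem theorem2p10:
  fixes M :: "'w measure" and T :: "'w \<Rightarrow> 'w" and MX :: "'x measure"
    and Xs :: "'w \<Rightarrow> 'x set" and f :: "'w \<Rightarrow> 'x \<Rightarrow> 'x" and m :: "'w \<Rightarrow> 'x measure"
    and N :: "('x \<Rightarrow> real) \<Rightarrow> ennreal"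
  assumes system: "random_system M T MX Xs f m"
    and norm: "is_norm_on (space MX) N"
    and norm_sup: "\<And>g. sup_norm (space MX) g \<le> N g"
    and norm_measurable: "\<And>g. N g < \<infinity> \<Longrightarrow> g \<in> borel_measurable MX"
  shows
    "((\<exists>C>0. \<exists>\<zeta>\<in>{0<..<1}. \<forall>g h. N g \<le> 1 \<longrightarrow> N h \<le> 1 \<longrightarrow> (\<forall>n.
         \<bar>\<integral>q. centered_square m g q * tensor_square h ((F2 T f ^^ n) q) \<partial>mu_hat2 M MX Xs m\<bar>
           \<le> C * \<zeta> ^ n))
      \<longrightarrow>
      (\<forall>g h. N g \<le> 1 \<longrightarrow> N h \<le> 1 \<longrightarrow> (\<forall>p\<ge>1. \<exists>c>0. \<exists>R. in_Lp M p R \<and>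
         (AE \<omega> in M. \<forall>n.
            \<bar>(\<integral>x. g x * h (fiter T f n \<omega> x) \<partial>m \<omega>)
               - (\<integral>x. g x \<partial>m \<omega>) * (\<integral>x. h (fiter T f n \<omega> x) \<partial>m \<omega>)\<bar>
            \<le> R \<omega> * exp (- c * real n)))))
     \<and>
     ((distr (mu_hat M MX Xs m) (E1_space M MX Xs) (F1 T f) = mu_hat M MX Xs m
         \<or> (\<forall>\<omega>\<in>space M. \<forall>\<omega>'\<in>space M. m \<omega> = m \<omega>' \<and> Xs \<omega> = Xs \<omega>'))
      \<longrightarrow>
      (\<forall>g h. N g \<le> 1 \<longrightarrow> N h \<le> 1 \<longrightarrow>
         (\<integral>x. g x \<partial>distr (mu_hat M MX Xs m) MX snd) = 0 \<longrightarrow>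
         (\<exists>C>0. \<exists>\<zeta>\<in>{0<..<1}. \<forall>n.
            \<bar>\<integral>q. tensor_square g q * tensor_square h ((F2 T f ^^ n) q) \<partial>mu_hat2 M MX Xs m\<bar>
              \<le> C * \<zeta> ^ n)
         \<longrightarrow>
         (\<forall>p\<ge>1. \<exists>c>0. \<exists>R. in_Lp M p R \<and>
            (AE \<omega> in M. \<forall>n.
               \<bar>\<integral>x. g x * h (fiter T f n \<omega> x) \<partial>m \<omega>\<bar> \<le> R \<omega> * exp (- c * real n)))))"
proof -
  interpret random_system M T MX Xs f m by (rule system)
  have meas: "g \<in> borel_measurable MX" if "N g \<le> 1" for g
    using that by (intro norm_measurable) (auto intro: le_less_trans)
  have le: "\<bar>g x\<bar> \<le> 1" if "N g \<le> 1" "x \<in> space MX" for g x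
    using order_trans[OF norm_sup that(1)] that(2) by (rule abs_le_1_if_sup_norm_le_1)
  show ?thesis
  proof (intro conjI impI allI)
    fix g h and p :: real
    assume "\<exists>C>0. \<exists>\<zeta>\<in>{0<..<1}. \<forall>g h. N g \<le> 1 \<longrightarrow> N h \<le> 1 \<longrightarrow> (\<forall>n.
         \<bar>\<integral>q. centered_square m g q * tensor_square h ((F2 T f ^^ n) q) \<partial>mu_hat2 M MX Xs m\<bar>
           \<le> C * \<zeta> ^ n)"
      and g: "N g \<le> 1" and h: "N h \<le> 1" and p: "1 \<le> p"
    then obtain C \<zeta> where \<zeta>: "\<zeta> \<in> {0<..<1}" and
      decay: "\<forall>n. \<bar>\<integral>q. centered_square m g q * tensor_square h ((F2 T f ^^ n) q) \<partial>mu_hat2 M MX Xs m\<bar>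
           \<le> C * \<zeta> ^ n"
      by blast
    show "\<exists>c>0. \<exists>R. in_Lp M p R \<and>
         (AE \<omega> in M. \<forall>n.
            \<bar>(\<integral>x. g x * h (fiter T f n \<omega> x) \<partial>m \<omega>)
               - (\<integral>x. g x \<partial>m \<omega>) * (\<integral>x. h (fiter T f n \<omega> x) \<partial>m \<omega>)\<bar>
            \<le> R \<omega> * exp (- c * real n))"
      using \<zeta> decay meas[OF g] meas[OF h] le[OF g] le[OF h] p
      by (intro fibre_covariance_decay[of g h C \<zeta>]) auto
  next
    fix g h and p :: real
    assume "\<exists>C>0. \<exists>\<zeta>\<in>{0<..<1}. \<forall>n.
         \<bar>\<integral>q. tensor_square g q * tensor_square h ((F2 T f ^^ n) q) \<partial>mu_hat2 M MX Xs m\<bar>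
           \<le> C * \<zeta> ^ n"
      and g: "N g \<le> 1" and h: "N h \<le> 1" and p: "1 \<le> p"
    then obtain C \<zeta> where \<zeta>: "\<zeta> \<in> {0<..<1}" and
      decay: "\<forall>n. \<bar>\<integral>q. tensor_square g q * tensor_square h ((F2 T f ^^ n) q) \<partial>mu_hat2 M MX Xs m\<bar>
           \<le> C * \<zeta> ^ n"
      by blast
    show "\<exists>c>0. \<exists>R. in_Lp M p R \<and>
         (AE \<omega> in M. \<forall>n.
            \<bar>\<integral>x. g x * h (fiter T f n \<omega> x) \<partial>m \<omega>\<bar> \<le> R \<omega> * exp (- c * real n))"
      using \<zeta> decay meas[OF g] meas[OF h] le[OF g] le[OF h] p
      by (intro fibre_correlation_decay[of g h C \<zeta>]) auto
  qed
qed

end
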